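(* Let $n\ge 1$, let $\theta_1,\dots,\theta_n>0$ be pairwise distinct, and let $X_1,\dots,X_n$ be independent random variables with $X_j\sim \mathrm{XG}(\theta_j)$ for $1\le j\le n$. Let $S_n=X_1+\cdots+X_n$. Then the probability density function of $S_n$ is $$f_{S_n}(t)=\sum_{i=1}^{n}\sum_{k=1}^{3}R_{ik}\,f_{Y_{ik}}(t),$$ where $Y_{ik}\sim \mathrm{Erl}(4-k,\theta_i)$ with density $f_{Y_{ik}}$, $$R_{ik}=\frac{A_{ik}}{\theta_i^{4-k}}\prod_{l=1}^{n}\frac{\theta_l^{2}}{1+\theta_l},$$ and, for $i=1,\dots,n$, $$A_{i1}=\theta_i\prod_{j=1,\,j\ne i}^{n}\frac{(\theta_j-\theta_i)^2+\theta_j}{(\theta_j-\theta_i)^3},$$ $$A_{i2}=A_{i1}\sum_{j=1,\,j\neq i}^{n}\left(\frac{2(\theta_j-\theta_i)}{(\theta_j-\theta_i)^2+\theta_j}-\frac{3}{\theta_j-\theta_i}\right),$$ $$A_{i3}=\frac{A_{i1}}{2}\left(\sum_{j=1,\,j\ne i}^{n}\left(\frac{2(\theta_j-\theta_i)}{(\theta_j-\theta_i)^2+\theta_j}-\frac{3}{\theta_j-\theta_i}\right)\right)^{2}+\frac{A_{i1}}{2}\left(\frac{2}{\theta_i}+\sum_{j=1,\,j\ne i}^{n}\left(-2\,\frac{(\theta_j-\theta_i)^2-\theta_j}{\left((\theta_j-\theta_i)^2+\theta_j\right)^2}+\frac{3}{(\theta_j-\theta_i)^2}\right)\right).$$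
   Context: XGamma distribution: for $\theta>0$, $X\sim \mathrm{XG}(\theta)$ means $X$ is a real random variable with density $\frac{\theta^2}{1+\theta}\left(1+\frac{\theta}{2}t^2\right)e^{-\theta t}$ for $t>0$, and $0$ otherwise. Erlang distribution: for an integer $m\ge 1$ and $\theta>0$, $Y\sim\mathrm{Erl}(m,\theta)$ means $Y$ has density $f_Y(t)=\frac{(\theta t)^{m-1}\theta e^{-\theta t}}{(m-1)!}$ for $t\ge 0$ and $0$ for $t<0$. Empty products equal $1$ and empty sums equal $0$. Densities are with respect to Lebesgue measure (determined up to null sets). *)

theory Defs
  imports "HOL-Probability.Probability"
begin

definition xgamma_density :: "real \<Rightarrow> real \<Rightarrow> real" where
  "xgamma_density \<theta> t =
    (if t > 0 then \<theta>\<^sup>2 / (1 + \<theta>) * (1 + \<theta> / 2 * t\<^sup>2) * exp (- \<theta> * t) else 0)"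

(* The library's erlang_density is parametrised by the exponent of t, i.e. by the shape minus one.
   Here m \<ge> 1 is the shape itself. *)
abbreviation erl_density :: "nat \<Rightarrow> real \<Rightarrow> real \<Rightarrow> real" where
  "erl_density m \<theta> \<equiv> erlang_density (m - 1) \<theta>"

definition coeff_A1 :: "nat \<Rightarrow> (nat \<Rightarrow> real) \<Rightarrow> nat \<Rightarrow> real" where
  "coeff_A1 n \<theta> i =
    \<theta> i * (\<Prod>j\<in>{1..n} - {i}. ((\<theta> j - \<theta> i)\<^sup>2 + \<theta> j) / (\<theta> j - \<theta> i) ^ 3)"

definition coeff_A2 :: "nat \<Rightarrow> (nat \<Rightarrow> real) \<Rightarrow> nat \<Rightarrow> real" where
  "coeff_A2 n \<theta> i =
    coeff_A1 n \<theta> i *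
      (\<Sum>j\<in>{1..n} - {i}.
        2 * (\<theta> j - \<theta> i) / ((\<theta> j - \<theta> i)\<^sup>2 + \<theta> j) - 3 / (\<theta> j - \<theta> i))"

definition coeff_A3 :: "nat \<Rightarrow> (nat \<Rightarrow> real) \<Rightarrow> nat \<Rightarrow> real" where
  "coeff_A3 n \<theta> i =
    coeff_A1 n \<theta> i / 2 *
      (\<Sum>j\<in>{1..n} - {i}.
        2 * (\<theta> j - \<theta> i) / ((\<theta> j - \<theta> i)\<^sup>2 + \<theta> j) - 3 / (\<theta> j - \<theta> i))\<^sup>2
    + coeff_A1 n \<theta> i / 2 *
      (2 / \<theta> i
        + (\<Sum>j\<in>{1..n} - {i}.
            - 2 * (((\<theta> j - \<theta> i)\<^sup>2 - \<theta> j) / ((\<theta> j - \<theta> i)\<^sup>2 + \<theta> j)\<^sup>2)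
            + 3 / (\<theta> j - \<theta> i)\<^sup>2))"

(* Meaningful for k = 1, 2, 3 only; other k fall into the last branch. *)
definition coeff_A :: "nat \<Rightarrow> (nat \<Rightarrow> real) \<Rightarrow> nat \<Rightarrow> nat \<Rightarrow> real" where
  "coeff_A n \<theta> i k =
    (if k = 1 then coeff_A1 n \<theta> i
     else if k = 2 then coeff_A2 n \<theta> i
     else coeff_A3 n \<theta> i)"

definition coeff_R :: "nat \<Rightarrow> (nat \<Rightarrow> real) \<Rightarrow> nat \<Rightarrow> nat \<Rightarrow> real" where
  "coeff_R n \<theta> i k =
    coeff_A n \<theta> i k / \<theta> i ^ (4 - k) * (\<Prod>l\<in>{1..n}. (\<theta> l)\<^sup>2 / (1 + \<theta> l))"

(* Densities in the library are ennreal-valued, and the coercion from real truncates negative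
   values to 0. For a real-valued density whose sign is not evident, nonnegativity (almost
   everywhere) therefore has to be demanded explicitly. *)
definition has_real_density :: "'a measure \<Rightarrow> ('a \<Rightarrow> real) \<Rightarrow> (real \<Rightarrow> real) \<Rightarrow> bool" where
  "has_real_density M X f \<longleftrightarrow>
    distributed M lborel X (\<lambda>t. ennreal (f t)) \<and> (AE t in lborel. 0 \<le> f t)"

end

theory Submission
  imports Defs
begin

text \<open>
  With $s = -it$, the characteristic function of $\mathrm{XG}(\theta)$ is
  $\frac{\theta^2}{1+\theta} \cdot \frac{(\theta+s)^2+\theta}{(\theta+s)^3}$ and that of
  $\mathrm{Erl}(m,\theta)$ is $(\theta/(\theta+s))^m$, so on the level of characteristic functions
  the claim is the partial fraction expansion of a product over $j$. The sum has some density, as an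
  iterated convolution; its difference from the claimed (a priori signed) density has vanishing
  Fourier transform, and hence vanishes almost everywhere by L\'evy's uniqueness theorem, which also
  yields the nonnegativity of the claimed density.
\<close>

section \<open>Partial fractions\<close>

text \<open>Distinct linear factors are coprime. By induction, \<open>p\<close> is the product over
  the remaining roots times a cofactor \<open>q\<close>; that product does not vanish at the new
  root, so the whole order of the root sits in \<open>q\<close>.\<close>

lemma prod_linear_power_dvd:
  fixes p :: "'a::idom poly"
  assumes "finite I" "inj_on a I" "\<And>i. i \<in> I \<Longrightarrow> [:- a i, 1:] ^ m dvd p"
  shows "(\<Prod>i\<in>I. [:- a i, 1:] ^ m) dvd p"
  using assms
proof (induction I rule: finite_induct)
  case (insert i I)
  let ?D = "\<Prod>i\<in>I. [:- a i, 1:] ^ m"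
  obtain q where q: "p = ?D * q"
    using insert by (auto elim!: dvdE)
  show ?case
  proof (cases "p = 0")
    case False
    have "poly ?D (a i) \<noteq> 0"
      using insert.hyps insert.prems(1) by (auto simp: poly_prod)
    then have "order (a i) ?D = 0"
      by (rule order_0I)
    with False have "order (a i) p = order (a i) q"
      unfolding q by (simp add: order_mult)
    with insert.prems(2)[of i] False have "[:- a i, 1:] ^ m dvd q"
      by (simp add: order_divides)
    then show ?thesis
      using insert.hyps by (auto simp: q mult.commute intro!: mult_dvd_mono)
  qed auto
qed auto

text \<open>Reading \<open>x dvd a - b\<close> as a congruence modulo \<open>x\<close>, this is
  compatibility with products, by telescoping the difference.\<close>

lemma dvd_diff_mult:
  fixes x :: "'a::comm_ring_1"
  assumes "x dvd a - b" "x dvd c - d"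
  shows "x dvd a * c - b * d"
proof -
  have "a * c - b * d = (a - b) * c + b * (c - d)"
    by (simp add: algebra_simps)
  with assms show ?thesis by simp
qed

lemma dvd_diff_trans:
  fixes x :: "'a::comm_ring_1"
  assumes "x dvd a - b" "x dvd b - c"
  shows "x dvd a - c"
  using dvd_add[OF assms] by simp

text \<open>
  The expansion of $\exp (L u + M u^2/2)$ modulo $u^3$. A product of factors with given first and
  second logarithmic derivatives $L$ and $M$ becomes a sum of these data, which is the shape of the
  coefficients $A_{i1}, A_{i2}, A_{i3}$.
\<close>

definition trunc_exp :: "'a::field \<Rightarrow> 'a \<Rightarrow> 'a poly" where
  "trunc_exp L M = [:1, L, (L\<^sup>2 + M) / 2:]"

lemma trunc_exp_0 [simp]: "trunc_exp 0 0 = 1"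
  by (simp add: trunc_exp_def one_pCons)

lemma coeffs_below_3_eq_0: "(\<forall>k<3. coeff p k = 0) \<longleftrightarrow> coeff p 0 = 0 \<and> coeff p 1 = 0 \<and> coeff p 2 = 0"
proof -
  have "k < 3 \<longleftrightarrow> k = 0 \<or> k = 1 \<or> k = 2" for k :: nat by auto
  then show ?thesis by metis
qed

text \<open>The functional equation of the exponential series, truncated modulo \<open>u^3\<close>;
  divisibility by \<open>monom 1 3\<close> says that the coefficients 0, 1 and 2 agree.\<close>

lemma trunc_exp_add:
  fixes L M l m :: "'a::field_char_0"
  shows "monom 1 3 dvd trunc_exp L M * trunc_exp l m - trunc_exp (L + l) (M + m)"
  unfolding monom_1_dvd_iff' coeffs_below_3_eq_0 trunc_exp_def
  by (simp add: numeral_2_eq_2 field_simps power2_eq_square)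

text \<open>Taylor expansion at \<open>u = 0\<close> of \<open>((d + u)^2 + c) / (d + u)^3\<close>:
  the scalar is its value there, and the arguments of \<open>trunc_exp\<close> are the first two
  derivatives of its logarithm. Multiplying by the denominator keeps the claim polynomial.\<close>

lemma trunc_exp_factor:
  fixes d c :: "'a::field_char_0"
  assumes d: "d \<noteq> 0" and q: "d\<^sup>2 + c \<noteq> 0"
  shows "monom 1 3 dvd [:d\<^sup>2 + c, 2 * d, 1:] -
    smult ((d\<^sup>2 + c) / d ^ 3) (trunc_exp (2 * d / (d\<^sup>2 + c) - 3 / d)
       (- 2 * ((d\<^sup>2 - c) / (d\<^sup>2 + c)\<^sup>2) + 3 / d\<^sup>2)) * [:d, 1:] ^ 3"
proof -
  \<comment> \<open>Eliminating \<open>c\<close> in favour of \<open>q\<close> turns every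
    denominator into a power of a nonzero variable, so that clearing denominators decides the
    identity.\<close>
  define q where "q = d\<^sup>2 + c"
  have c: "c = q - d\<^sup>2" and "q \<noteq> 0" using q by (auto simp: q_def)
  show ?thesis
    unfolding monom_1_dvd_iff' coeffs_below_3_eq_0 trunc_exp_def q_def[symmetric] unfolding c
    using d \<open>q \<noteq> 0\<close>
    by (simp add: numeral_2_eq_2 numeral_3_eq_3) (simp add: field_simps)
qed

text \<open>Congruences modulo \<open>u^3\<close> multiply, and logarithmic derivatives add.\<close>

lemma trunc_exp_prod:
  fixes d c :: "'b \<Rightarrow> 'a::field_char_0"
  assumes "finite J" "\<And>j. j \<in> J \<Longrightarrow> d j \<noteq> 0" "\<And>j. j \<in> J \<Longrightarrow> (d j)\<^sup>2 + c j \<noteq> 0"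
  shows "monom 1 3 dvd (\<Prod>j\<in>J. [:(d j)\<^sup>2 + c j, 2 * d j, 1:]) -
    smult (\<Prod>j\<in>J. ((d j)\<^sup>2 + c j) / d j ^ 3)
      (trunc_exp (\<Sum>j\<in>J. 2 * d j / ((d j)\<^sup>2 + c j) - 3 / d j)
       (\<Sum>j\<in>J. - 2 * (((d j)\<^sup>2 - c j) / ((d j)\<^sup>2 + c j)\<^sup>2) + 3 / (d j)\<^sup>2)) *
    (\<Prod>j\<in>J. [:d j, 1:] ^ 3)"
  using assms
proof (induction J rule: finite_induct)
  case (insert i J)
  let ?a = "\<lambda>j. ((d j)\<^sup>2 + c j) / d j ^ 3"
  let ?l = "\<lambda>j. 2 * d j / ((d j)\<^sup>2 + c j) - 3 / d j"
  let ?m = "\<lambda>j. - 2 * (((d j)\<^sup>2 - c j) / ((d j)\<^sup>2 + c j)\<^sup>2) + 3 / (d j)\<^sup>2"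
  let ?N = "\<lambda>j. [:(d j)\<^sup>2 + c j, 2 * d j, 1:]"
  let ?D = "\<lambda>j. [:d j, 1:] ^ 3"
  let ?E = "trunc_exp (?l i) (?m i) * trunc_exp (sum ?l J) (sum ?m J)"
  let ?E' = "trunc_exp (?l i + sum ?l J) (?m i + sum ?m J)"
  let ?R = "smult (?a i * prod ?a J) (?D i * prod ?D J)"
  \<comment> \<open>Collecting scalars and denominators into \<open>?R\<close> leaves just the
    product of the two truncated exponentials to be merged.\<close>
  have eq: "(smult (?a i) A * ?D i) * (smult (prod ?a J) B * prod ?D J) = A * B * ?R" for A B
    by (simp only: mult_smult_left mult_smult_right smult_smult) (simp only: mult_ac)
  have "monom 1 3 dvd ?N i * prod ?N J - ?E * ?R"
    unfolding eq[symmetric] using insert.prems insert.IH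
    by (intro dvd_diff_mult trunc_exp_factor) blast+
  moreover have "monom 1 3 dvd ?E * ?R - ?E' * ?R"
    unfolding left_diff_distrib[symmetric] by (intro dvd_mult2 trunc_exp_add)
  ultimately have "monom 1 3 dvd ?N i * prod ?N J - ?E' * ?R"
    by (rule dvd_diff_trans)
  then show ?case
    unfolding prod.insert[OF insert.hyps] sum.insert[OF insert.hyps]
    by (simp only: mult_smult_left mult_smult_right)
qed (simp add: one_pCons)

text \<open>In the coordinate \<open>u = t + x\<close> around the pole \<open>x = -t\<close>, the
  first three Taylor coefficients of the product without its denominator \<open>u^3\<close> are the
  numerators over \<open>u^3\<close>, \<open>u^2\<close> and \<open>u\<close>. Divisibility by
  \<open>[:t, 1:] ^ 3\<close> says that these have been matched.\<close>

lemma partial_fractions_principal_part: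
  fixes \<theta> :: "'b \<Rightarrow> 'a::field_char_0"
  assumes "finite J" and t: "t \<noteq> 0" and "\<And>j. j \<in> J \<Longrightarrow> \<theta> j \<noteq> t"
    and "\<And>j. j \<in> J \<Longrightarrow> (\<theta> j - t)\<^sup>2 + \<theta> j \<noteq> 0"
  defines "a \<equiv> t * (\<Prod>j\<in>J. ((\<theta> j - t)\<^sup>2 + \<theta> j) / (\<theta> j - t) ^ 3)"
    and "L \<equiv> \<Sum>j\<in>J. 2 * (\<theta> j - t) / ((\<theta> j - t)\<^sup>2 + \<theta> j) - 3 / (\<theta> j - t)"
    and "M \<equiv> 2 / t + (\<Sum>j\<in>J. - 2 * (((\<theta> j - t)\<^sup>2 - \<theta> j) / ((\<theta> j - t)\<^sup>2 + \<theta> j)\<^sup>2) + 3 / (\<theta> j - t)\<^sup>2)"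
  shows "[:t, 1:] ^ 3 dvd ([:t\<^sup>2 + t, 2 * t, 1:] * (\<Prod>j\<in>J. [:(\<theta> j)\<^sup>2 + \<theta> j, 2 * \<theta> j, 1:])) -
    pcompose [:a, a * L, a / 2 * L\<^sup>2 + a / 2 * M:] [:t, 1:] * (\<Prod>j\<in>J. [:\<theta> j, 1:] ^ 3)"
proof -
  let ?d = "\<lambda>j. \<theta> j - t"
  define b where "b = (\<Prod>j\<in>J. ((\<theta> j - t)\<^sup>2 + \<theta> j) / (\<theta> j - t) ^ 3)"
  define M' where "M' = (\<Sum>j\<in>J. - 2 * (((\<theta> j - t)\<^sup>2 - \<theta> j) / ((\<theta> j - t)\<^sup>2 + \<theta> j)\<^sup>2) + 3 / (\<theta> j - t)\<^sup>2)"
  let ?N = "\<Prod>j\<in>J. [:(?d j)\<^sup>2 + \<theta> j, 2 * ?d j, 1:]"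
  let ?D = "\<Prod>j\<in>J. [:?d j, 1:] ^ 3"
  have 1: "monom 1 3 dvd ?N - smult b (trunc_exp L M') * ?D"
    using assms(1,3,4) trunc_exp_prod[of J ?d \<theta>] unfolding b_def L_def M'_def by simp
  \<comment> \<open>The numerator \<open>u^2 + t\<close> belonging to the pole itself has
    logarithmic derivatives \<open>0\<close> and \<open>2 / t\<close> at \<open>u = 0\<close>; this
    is the origin of the leading factor \<open>t\<close> in \<open>a\<close> and of the term
    \<open>2 / t\<close> in \<open>M\<close>.\<close>
  have 2: "[:t, 0, 1:] = smult t (trunc_exp 0 (2 / t))"
    using t by (simp add: trunc_exp_def)
  \<comment> \<open>The multipliers are chosen so that the mixed terms cancel and the sum becomes
    the wanted difference.\<close>
  have "monom 1 3 dvd [:t, 0, 1:] * (?N - smult b (trunc_exp L M') * ?D)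
      + smult (t * b) ?D * (trunc_exp 0 (2 / t) * trunc_exp L M' - trunc_exp (0 + L) (2 / t + M'))"
    using 1 trunc_exp_add by (intro dvd_add dvd_mult)
  also have "[:t, 0, 1:] * (?N - smult b (trunc_exp L M') * ?D)
      + smult (t * b) ?D * (trunc_exp 0 (2 / t) * trunc_exp L M' - trunc_exp (0 + L) (2 / t + M'))
    = [:t, 0, 1:] * ?N - smult a (trunc_exp L M) * ?D"
    unfolding 2 by (simp add: algebra_simps a_def b_def M_def M'_def)
  also have "smult a (trunc_exp L M) = [:a, a * L, a / 2 * L\<^sup>2 + a / 2 * M:]"
    by (simp add: trunc_exp_def field_simps)
  \<comment> \<open>Substituting \<open>u = t + x\<close> is a ring homomorphism, hence preserves
    divisibility.\<close>
  finally have "pcompose (monom 1 3) [:t, 1:] dvd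
     pcompose ([:t, 0, 1:] * ?N - [:a, a * L, a / 2 * L\<^sup>2 + a / 2 * M:] * ?D) [:t, 1:]"
    unfolding dvd_def by (elim exE) (simp only: pcompose_mult, blast)
  moreover have "pcompose (monom 1 3) [:t, 1:] = [:t, 1:] ^ 3"
    by (simp add: monom_altdef pcompose_pCons numeral_3_eq_3 pcompose_mult pcompose_1)
  moreover have "pcompose [:t, 0, 1:] [:t, 1:] = [:t\<^sup>2 + t, 2 * t, 1:]"
    by (simp add: pcompose_pCons power2_eq_square algebra_simps)
  moreover have "pcompose ?N [:t, 1:] = (\<Prod>j\<in>J. [:(\<theta> j)\<^sup>2 + \<theta> j, 2 * \<theta> j, 1:])"
    unfolding pcompose_prod
    by (intro prod.cong refl) (simp add: pcompose_pCons power2_eq_square algebra_simps)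
  moreover have "pcompose ?D [:t, 1:] = (\<Prod>j\<in>J. [:\<theta> j, 1:] ^ 3)"
    unfolding pcompose_prod
    by (intro prod.cong refl)
      (simp only: numeral_3_eq_3 power_Suc power_0 pcompose_mult pcompose_1, simp add: pcompose_pCons)
  ultimately show ?thesis
    by (simp only: pcompose_mult pcompose_diff)
qed

text \<open>After clearing denominators, the difference \<open>P\<close> of the two sides is
  divisible by the full denominator of degree \<open>3 * card I\<close> but has smaller degree, so
  it is zero; evaluation at \<open>s\<close> then gives the identity.\<close>

lemma partial_fractions:
  fixes \<theta> :: "'b \<Rightarrow> 'a::field_char_0"
  assumes fin: "finite I" and ne: "I \<noteq> {}" and inj: "inj_on \<theta> I"
    and nz: "\<And>i. i \<in> I \<Longrightarrow> \<theta> i \<noteq> 0"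
    and num: "\<And>i j. i \<in> I \<Longrightarrow> j \<in> I \<Longrightarrow> i \<noteq> j \<Longrightarrow> (\<theta> j - \<theta> i)\<^sup>2 + \<theta> j \<noteq> 0"
    and s: "\<And>i. i \<in> I \<Longrightarrow> \<theta> i + s \<noteq> 0"
  defines "a \<equiv> \<lambda>i. \<theta> i * (\<Prod>j\<in>I - {i}. ((\<theta> j - \<theta> i)\<^sup>2 + \<theta> j) / (\<theta> j - \<theta> i) ^ 3)"
    and "L \<equiv> \<lambda>i. \<Sum>j\<in>I - {i}. 2 * (\<theta> j - \<theta> i) / ((\<theta> j - \<theta> i)\<^sup>2 + \<theta> j) - 3 / (\<theta> j - \<theta> i)"
    and "M \<equiv> \<lambda>i. 2 / \<theta> i + (\<Sum>j\<in>I - {i}.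
      - 2 * (((\<theta> j - \<theta> i)\<^sup>2 - \<theta> j) / ((\<theta> j - \<theta> i)\<^sup>2 + \<theta> j)\<^sup>2) + 3 / (\<theta> j - \<theta> i)\<^sup>2)"
  shows "(\<Prod>i\<in>I. ((\<theta> i + s)\<^sup>2 + \<theta> i) / (\<theta> i + s) ^ 3) =
    (\<Sum>i\<in>I. a i / (\<theta> i + s) ^ 3 + a i * L i / (\<theta> i + s)\<^sup>2 +
      (a i / 2 * (L i)\<^sup>2 + a i / 2 * M i) / (\<theta> i + s))"
proof -
  define N where "N = (\<lambda>j. [:(\<theta> j)\<^sup>2 + \<theta> j, 2 * \<theta> j, 1:])"
  define D where "D = (\<lambda>j. [:\<theta> j, 1:] ^ 3)"
  define E where "E = (\<lambda>i. pcompose [:a i, a i * L i, a i / 2 * (L i)\<^sup>2 + a i / 2 * M i:] [:\<theta> i, 1:])"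
  define P where "P = prod N I - (\<Sum>i\<in>I. E i * prod D (I - {i}))"
  have "D i dvd P" if i: "i \<in> I" for i
  proof -
    \<comment> \<open>Each summand with \<open>k\<close> different from \<open>i\<close> contains
      the factor \<open>D i\<close>; the rest is the principal part at the pole of index
      \<open>i\<close>.\<close>
    have "P = (N i * prod N (I - {i}) - E i * prod D (I - {i})) - (\<Sum>k\<in>I - {i}. E k * prod D (I - {k}))"
      unfolding P_def prod.remove[OF fin i, of N] sum.remove[OF fin i] by simp
    moreover have "D i dvd N i * prod N (I - {i}) - E i * prod D (I - {i})"
      unfolding N_def D_def E_def a_def L_def M_def
      using fin nz[OF i] num[OF i] inj_onD[OF inj _ _ i]
      by (intro partial_fractions_principal_part) auto
    moreover have "D i dvd (\<Sum>k\<in>I - {i}. E k * prod D (I - {k}))"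
      using i fin by (intro dvd_sum dvd_mult dvd_prodI) auto
    ultimately show ?thesis
      by simp
  qed
  then have dvd: "prod D I dvd P"
    using prod_linear_power_dvd[of I "\<lambda>i. - \<theta> i" 3 P] fin inj
    by (simp add: D_def inj_on_def)
  have degD: "degree (prod D A) = 3 * card A" for A
    unfolding D_def by (subst degree_prod_sum_eq) (auto simp: degree_linear_power)
  have "degree (prod N I) \<le> 2 * card I"
    using degree_prod_sum_le[OF fin, of N] by (simp add: N_def)
  \<comment> \<open>Nonemptiness makes the degree bounds strict; for empty \<open>I\<close> the
    product is 1 and the sum is 0.\<close>
  moreover have "card I > 0"
    using fin ne by (simp add: card_gt_0_iff)
  ultimately have "degree (prod N I) < 3 * card I"
    by simp
  moreover have "degree (\<Sum>i\<in>I. E i * prod D (I - {i})) < 3 * card I"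
  proof (rule degree_sum_less)
    fix i assume i: "i \<in> I"
    have "degree (E i) \<le> 2"
      unfolding E_def by (simp add: degree_pcompose)
    then have "degree (E i * prod D (I - {i})) \<le> 2 + 3 * card (I - {i})"
      using degree_mult_le[of "E i" "prod D (I - {i})"] degD by simp
    also have "\<dots> < 3 * card I"
      using card_Suc_Diff1[OF fin i] by simp
    finally show "degree (E i * prod D (I - {i})) < 3 * card I" .
  qed (use \<open>card I > 0\<close> in simp)
  ultimately have "degree P < degree (prod D I)"
    unfolding P_def degD by (rule degree_diff_less)
  with dvd have "P = 0"
    by (metis dvd_imp_degree_le not_le)
  then have "poly (prod N I) s = poly (\<Sum>i\<in>I. E i * prod D (I - {i})) s"
    unfolding P_def by simp
  also have "poly (prod N I) s = (\<Prod>i\<in>I. (\<theta> i + s)\<^sup>2 + \<theta> i)"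
    unfolding poly_prod N_def by (intro prod.cong) (simp_all add: power2_eq_square algebra_simps)
  finally have "(\<Prod>i\<in>I. ((\<theta> i + s)\<^sup>2 + \<theta> i) / (\<theta> i + s) ^ 3) =
      (\<Sum>i\<in>I. poly (E i) s * poly (prod D (I - {i})) s / (\<Prod>i\<in>I. (\<theta> i + s) ^ 3))"
    by (simp add: prod_dividef poly_sum sum_divide_distrib)
  also have "\<dots> = (\<Sum>i\<in>I. poly (E i) s / (\<theta> i + s) ^ 3)"
  proof (rule sum.cong)
    fix i assume i: "i \<in> I"
    have "poly (prod D (I - {i})) s = (\<Prod>i\<in>I - {i}. (\<theta> i + s) ^ 3)"
      by (simp add: poly_prod D_def)
    moreover have "(\<Prod>i\<in>I - {i}. (\<theta> i + s) ^ 3) \<noteq> 0"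
      using s fin by simp
    ultimately show "poly (E i) s * poly (prod D (I - {i})) s / (\<Prod>i\<in>I. (\<theta> i + s) ^ 3) =
        poly (E i) s / (\<theta> i + s) ^ 3"
      by (simp add: prod.remove[OF fin i])
  qed simp
  also have "\<dots> = (\<Sum>i\<in>I. a i / (\<theta> i + s) ^ 3 + a i * L i / (\<theta> i + s)\<^sup>2 +
      (a i / 2 * (L i)\<^sup>2 + a i / 2 * M i) / (\<theta> i + s))"
  proof (rule sum.cong)
    fix i assume i: "i \<in> I"
    have "poly (pcompose [:x, y, z:] [:\<theta> i, 1:]) s = x + (\<theta> i + s) * y + (\<theta> i + s)\<^sup>2 * z" for x y z
      by (simp add: poly_pcompose power2_eq_square algebra_simps)
    then have "poly (E i) s = a i + (\<theta> i + s) * (a i * L i) + (\<theta> i + s)\<^sup>2 * (a i / 2 * (L i)\<^sup>2 + a i / 2 * M i)"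
      unfolding E_def .
    moreover have "(x + u * y + u\<^sup>2 * z) / u ^ 3 = x / u ^ 3 + y / u\<^sup>2 + z / u"
      if "u \<noteq> 0" for u x y z :: 'a
      using that by (simp add: add_divide_distrib power2_eq_square power3_eq_cube)
    ultimately show "poly (E i) s / (\<theta> i + s) ^ 3 = a i / (\<theta> i + s) ^ 3 + a i * L i / (\<theta> i + s)\<^sup>2 +
      (a i / 2 * (L i)\<^sup>2 + a i / 2 * M i) / (\<theta> i + s)"
      using s[OF i] by metis
  qed simp
  finally show ?thesis .
qed

section \<open>Fourier transforms\<close>

lemma integrable_erlang_density:
  assumes "l > 0"
  shows "integrable lborel (erlang_density k l)"
proof -
  interpret prob_space "density lborel (erlang_density k l)"
    using assms by (rule prob_space_erlang_density)
  have "integrable (density lborel (erlang_density k l)) (\<lambda>x. 1 :: real)"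
    by simp
  then show ?thesis
    using assms by (subst (asm) integrable_density) auto
qed

lemma integrable_power_exp:
  fixes l :: real
  assumes "l > 0"
  shows "set_integrable lborel {0<..} (\<lambda>x. x ^ k * exp (- l * x))"
proof -
  have "integrable lborel (\<lambda>x. fact k / l ^ Suc k * (indicator {0<..} x *\<^sub>R erlang_density k l x))"
    using integrable_erlang_density[OF assms]
    by (intro integrable_mult_right integrable_mult_indicator) auto
  also have "(\<lambda>x. fact k / l ^ Suc k * (indicator {0<..} x *\<^sub>R erlang_density k l x)) =
      (\<lambda>x. indicator {0<..} x *\<^sub>R (x ^ k * exp (- l * x)))"
    using assms by (auto simp: erlang_density_def fun_eq_iff split: split_indicator)
  finally show ?thesis
    unfolding set_integrable_def .
qed

lemma integrable_power_exp_complex: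
  fixes w :: complex
  assumes "Re w > 0"
  shows "set_integrable lborel {0<..} (\<lambda>x. of_real x ^ k * exp (- w * of_real x))"
  unfolding set_integrable_def
proof (rule Bochner_Integration.integrable_bound)
  show "integrable lborel (\<lambda>x. indicator {0<..} x *\<^sub>R (x ^ k * exp (- Re w * x)))"
    using integrable_power_exp[OF assms, of k] unfolding set_integrable_def .
qed (auto simp: norm_mult norm_power split: split_indicator)

lemma tendsto_power_exp_complex:
  fixes w :: complex
  assumes "Re w > 0"
  shows "((\<lambda>x. of_real x ^ k * exp (- w * of_real x)) \<longlongrightarrow> 0) at_top"
proof (rule tendsto_norm_zero_cancel)
  \<comment> \<open>The norm rewritten in \<open>y = Re w * x\<close>, to use that
    \<open>y ^ k / exp y\<close> tends to 0.\<close>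
  have "((\<lambda>x. (1 / Re w) ^ k * ((Re w * x) ^ k / exp (Re w * x))) \<longlongrightarrow> (1 / Re w) ^ k * 0) at_top"
    using assms
    by (intro tendsto_intros filterlim_compose[OF tendsto_power_div_exp_0]
          filterlim_tendsto_pos_mult_at_top[OF tendsto_const] filterlim_ident)
  moreover have "\<forall>\<^sub>F x in at_top. (1 / Re w) ^ k * ((Re w * x) ^ k / exp (Re w * x)) =
      norm (of_real x ^ k * exp (- w * of_real x))"
    using eventually_ge_at_top[of "0::real"]
    by eventually_elim (use assms in \<open>simp add: norm_mult norm_power, simp add: exp_minus field_simps\<close>)
  ultimately show "((\<lambda>x. norm (of_real x ^ k * exp (- w * of_real x))) \<longlongrightarrow> 0) at_top"
    by (simp add: Lim_transform_eventually)
qed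

text \<open>Induction on \<open>k\<close> by integration by parts. Complex \<open>w\<close> is
  essential, since \<open>w = l - \<i> * t\<close> yields the Fourier transform.\<close>

lemma Laplace_power:
  fixes w :: complex
  assumes w: "Re w > 0"
  shows "(LINT x:{0<..}|lborel. of_real x ^ k * exp (- w * of_real x)) = fact k / w ^ Suc k"
proof -
  let ?f = "\<lambda>k x. of_real x ^ k * exp (- w * of_real x) :: complex"
  have [simp]: "w \<noteq> 0" using w by auto
  \<comment> \<open>Fundamental theorem of calculus on the half-line for an antiderivative vanishing
    at infinity.\<close>
  have FTC: "(LINT x:{0<..}|lborel. f x) = - F 0"
    if "\<And>x. x > 0 \<Longrightarrow> (F has_vector_derivative f x) (at x)"
      "\<And>x. isCont f x" "\<And>x. isCont F x"
      "set_integrable lborel {0<..} f" "(F \<longlongrightarrow> 0) at_top" for F f :: "real \<Rightarrow> complex"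
  proof -
    have "(LBINT x=0..\<infinity>. f x) = 0 - F 0"
    proof (rule interval_integral_FTC_integrable)
      show "((F \<circ> real_of_ereal) \<longlongrightarrow> F 0) (at_right 0)"
        using that(3)[of 0] unfolding zero_ereal_def ereal_tendsto_simps
        by (simp add: isCont_def filterlim_at_split)
      show "((F \<circ> real_of_ereal) \<longlongrightarrow> 0) (at_left \<infinity>)"
        using that(5) by (simp add: ereal_tendsto_simps)
    qed (use that in \<open>auto simp: zero_ereal_def\<close>)
    then show ?thesis
      by (simp add: interval_lebesgue_integral_0_infty)
  qed
  show ?thesis
  proof (induction k)
    case 0
    have "(LINT x:{0<..}|lborel. ?f 0 x) = - (- (1 / w) * ?f 0 0)"
    proof (rule FTC)
      fix x :: real
      show "((\<lambda>x. - (1 / w) * ?f 0 x) has_vector_derivative ?f 0 x) (at x)"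
        by (auto intro!: derivative_eq_intros has_vector_derivative_real_field simp: field_simps)
      show "((\<lambda>x. - (1 / w) * ?f 0 x) \<longlongrightarrow> 0) at_top"
        using tendsto_mult_left[OF tendsto_power_exp_complex[OF w, of 0], of "- (1 / w)"] by simp
    qed (use integrable_power_exp_complex[OF w, of 0] in \<open>auto intro!: continuous_intros\<close>)
    then show ?case by simp
  next
    case (Suc k)
    \<comment> \<open>\<open>?g\<close> is the derivative of \<open>?f (Suc k)\<close>, which
      vanishes at 0 and at infinity; its zero integral is the recursion from \<open>k\<close> to
      \<open>Suc k\<close>.\<close>
    let ?g = "\<lambda>x. of_nat (Suc k) * ?f k x - w * ?f (Suc k) x"
    note int = integrable_power_exp_complex[OF w]
    have "(LINT x:{0<..}|lborel. ?g x) = - ?f (Suc k) 0"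
    proof (rule FTC)
      fix x :: real
      have "((\<lambda>z. z ^ Suc k) has_field_derivative of_nat (Suc k) * of_real x ^ k) (at (of_real x :: complex))"
        using DERIV_power_Suc[OF DERIV_ident, of k "of_real x :: complex"] by simp
      moreover have "((\<lambda>z. exp (- w * z)) has_field_derivative - w * exp (- w * of_real x)) (at (of_real x))"
        by (auto intro!: derivative_eq_intros)
      ultimately have "((\<lambda>z. z ^ Suc k * exp (- w * z)) has_field_derivative ?g x) (at (of_real x))"
        by (rule DERIV_cong[OF DERIV_mult]) (simp add: algebra_simps)
      then show "(?f (Suc k) has_vector_derivative ?g x) (at x)"
        by (rule has_vector_derivative_real_field)
      show "(?f (Suc k) \<longlongrightarrow> 0) at_top"
        by (rule tendsto_power_exp_complex[OF w])
      show "set_integrable lborel {0<..} ?g"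
        by (intro set_integral_diff set_integrable_mult_right int)
    qed (auto intro!: continuous_intros)
    moreover have "(LINT x:{0<..}|lborel. ?g x) = of_nat (Suc k) * (LINT x:{0<..}|lborel. ?f k x)
        - w * (LINT x:{0<..}|lborel. ?f (Suc k) x)"
      using int[of k] int[of "Suc k"]
      by (subst set_integral_diff) (auto intro!: set_integrable_mult_right simp del: power_Suc)
    moreover have "?f (Suc k) 0 = 0"
      by simp
    ultimately have "of_nat (Suc k) * (LINT x:{0<..}|lborel. ?f k x) - w * (LINT x:{0<..}|lborel. ?f (Suc k) x) = 0"
      by (metis minus_zero)
    then have "of_nat (Suc k) * (fact k / w ^ Suc k) = w * (LINT x:{0<..}|lborel. ?f (Suc k) x)"
      unfolding Suc.IH by (rule eq_iff_diff_eq_0[THEN iffD2])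
    moreover have "B = fact (Suc k) / w ^ Suc (Suc k)" if "of_nat (Suc k) * (fact k / w ^ Suc k) = w * B" for B
      using that by (simp add: field_simps)
    ultimately show ?case
      by blast
  qed
qed

lemma Fourier_erlang_density:
  assumes "l > 0"
  shows "(CLINT x|lborel. erlang_density k l x *\<^sub>R iexp (t * x)) = (l / (l - \<i> * t)) ^ Suc k"
proof -
  \<comment> \<open>Equality holds only almost everywhere: for \<open>k = 0\<close> the Erlang
    density is nonzero at 0, which \<open>{0<..}\<close> leaves out.\<close>
  have "(CLINT x|lborel. erlang_density k l x *\<^sub>R iexp (t * x)) =
      (CLINT x|lborel. (l ^ Suc k / fact k) * (indicator {0<..} x *\<^sub>R (of_real x ^ k * exp (- (l - \<i> * t) * of_real x))))"
    using AE_lborel_singleton[of "0::real"]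
    by (intro integral_cong_AE)
      (auto simp: erlang_density_def scaleR_conv_of_real exp_of_real[symmetric] exp_add[symmetric] algebra_simps split: split_indicator)
  also have "\<dots> = (l ^ Suc k / fact k) * (fact k / (l - \<i> * t) ^ Suc k)"
  proof -
    have "(CLINT x|lborel. indicator {0<..} x *\<^sub>R (of_real x ^ k * exp (- (l - \<i> * t) * of_real x))) =
        fact k / (l - \<i> * t) ^ Suc k"
      using Laplace_power[of "l - \<i> * t" k] assms unfolding set_lebesgue_integral_def by simp
    then show ?thesis
      by (simp only: integral_mult_right_zero)
  qed
  finally show ?thesis
    by (simp add: power_divide)
qed

section \<open>Injectivity of the Fourier transform on integrable real functions\<close>

lemma integrable_scaleR_iexp:
  assumes "integrable lborel h"
  shows "integrable lborel (\<lambda>x. h x *\<^sub>R iexp (t * x))"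
  using assms by (rule Bochner_Integration.integrable_bound) (use assms in auto)

lemma Fourier_zero_imp_AE_zero:
  fixes h :: "real \<Rightarrow> real"
  assumes h: "integrable lborel h"
    and zero: "\<And>t. (CLINT x|lborel. h x *\<^sub>R iexp (t * x)) = 0"
  shows "AE x in lborel. h x = 0"
proof -
  \<comment> \<open>The positive and the negative part of \<open>h\<close> have the same transform, in particular the same mass,
    so after normalisation they are probability densities with the same characteristic function.\<close>
  define p where "p = (\<lambda>x. max 0 (h x))"
  define m where "m = (\<lambda>x. max 0 (- h x))"
  have p: "integrable lborel p" and m: "integrable lborel m"
    using h unfolding p_def m_def by (auto intro!: integrable_max)
  have [simp]: "p x \<ge> 0" "m x \<ge> 0" for x by (auto simp: p_def m_def)
  have hpm: "h x = p x - m x" for x by (auto simp: p_def m_def)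
  have eq: "(CLINT x|lborel. p x *\<^sub>R iexp (t * x)) = (CLINT x|lborel. m x *\<^sub>R iexp (t * x))" for t
    using zero[of t] integrable_scaleR_iexp[OF p, of t] integrable_scaleR_iexp[OF m, of t]
    unfolding hpm by (simp add: scaleR_diff_left)
  define c where "c = (\<integral>x. p x \<partial>lborel)"
  have cm: "c = (\<integral>x. m x \<partial>lborel)"
    using eq[of 0] integral_of_real[of lborel p, where 'a=complex] integral_of_real[of lborel m, where 'a=complex]
    by (simp add: c_def scaleR_conv_of_real del: integral_of_real)
  have "c \<ge> 0" by (simp add: c_def)
  \<comment> \<open>Normalisation requires positive mass; if the common mass is 0, both parts vanish
    almost everywhere.\<close>
  show ?thesis
  proof (cases "c = 0")
    case True
    then have "AE x in lborel. p x = 0" "AE x in lborel. m x = 0"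
      using integral_nonneg_eq_0_iff_AE[OF p] integral_nonneg_eq_0_iff_AE[OF m] cm c_def by auto
    then show ?thesis by eventually_elim (simp add: hpm)
  next
    case False
    with \<open>c \<ge> 0\<close> have c: "c > 0" by simp
    define D where "D = (\<lambda>f :: real \<Rightarrow> real. density lborel (\<lambda>x. ennreal (f x / c)))"
    have D: "real_distribution (D f)" "char (D f) t = (CLINT x|lborel. f x *\<^sub>R iexp (t * x)) / c"
      if f: "integrable lborel f" "\<And>x. f x \<ge> 0" "c = (\<integral>x. f x \<partial>lborel)" for f t
    proof -
      have "emeasure (D f) (space (D f)) = ennreal (\<integral>x. f x / c \<partial>lborel)"
        unfolding D_def using f c by (simp add: emeasure_density nn_integral_eq_integral)
      then show "real_distribution (D f)"
        using c f(3) by (intro real_distribution.intro prob_spaceI real_distribution_axioms.intro) (auto simp: D_def)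
      have "char (D f) t = (CLINT x|lborel. (f x / c) *\<^sub>R iexp (t * x))"
        unfolding D_def char_def using f c by (subst integral_density) auto
      also have "\<dots> = (CLINT x|lborel. (f x *\<^sub>R iexp (t * x)) / c)"
        by (simp add: scaleR_conv_of_real)
      finally show "char (D f) t = (CLINT x|lborel. f x *\<^sub>R iexp (t * x)) / c"
        by simp
    qed
    have "D p = D m"
      using D[of p] D[of m] p m c_def cm eq by (intro Levy_uniqueness ext) auto
    moreover have "sigma_finite_measure (D p)"
      using D(1)[of p] p c_def unfolding real_distribution_def
      by (auto intro: prob_space_imp_sigma_finite)
    ultimately have "AE x in lborel. ennreal (p x / c) = ennreal (m x / c)"
      unfolding D_def using p m by (subst (asm) sigma_finite_density_unique) auto
    then show ?thesis
      by eventually_elim (use c in \<open>simp add: hpm\<close>)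
  qed
qed

section \<open>Densities of sums\<close>

text \<open>Iterates the convolution of two independent variables, keeping only the existence of a
  density. The induction starts from a single index, as the empty sum is constant and has no
  density.\<close>

lemma (in prob_space) distributed_sum_ex_density:
  fixes X :: "'i \<Rightarrow> 'a \<Rightarrow> real"
  assumes "finite I" "I \<noteq> {}" "indep_vars (\<lambda>_. borel) X I"
    and "\<And>i. i \<in> I \<Longrightarrow> \<exists>g. distributed M lborel (X i) g"
  shows "\<exists>g. distributed M lborel (\<lambda>\<omega>. \<Sum>i\<in>I. X i \<omega>) g"
  using assms
proof (induction I rule: finite_ne_induct)
  case (insert i I)
  then obtain f g where "distributed M lborel (X i) f" "distributed M lborel (\<lambda>\<omega>. \<Sum>i\<in>I. X i \<omega>) g"
    using indep_vars_subset[of "\<lambda>_. borel" X "insert i I" I] by blast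
  moreover have "indep_var borel (X i) borel (\<lambda>\<omega>. \<Sum>i\<in>I. X i \<omega>)"
    using insert by (intro indep_vars_sum) auto
  ultimately show ?case
    using insert.hyps distributed_convolution by (fastforce simp: sum.insert)
qed simp

text \<open>Nonnegativity almost everywhere makes the truncation by \<open>ennreal\<close> harmless,
  so the characteristic function is the Fourier integral of the real function
  \<open>f\<close>.\<close>

lemma (in prob_space) char_distributed:
  assumes X: "distributed M lborel X (\<lambda>x. ennreal (f x))"
    and f[measurable]: "f \<in> borel_measurable borel" and nonneg: "AE x in lborel. 0 \<le> f x"
  shows "integrable lborel f"
    and "char (distr M borel X) t = (CLINT x|lborel. f x *\<^sub>R iexp (t * x))"
proof -
  have "X \<in> measurable M lborel"
    using X by (rule distributed_measurable)
  then interpret D: prob_space "density lborel (\<lambda>x. ennreal (f x))"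
    unfolding distributed_distr_eq_density[OF X, symmetric] by (rule prob_space_distr)
  have "integrable (density lborel (\<lambda>x. ennreal (f x))) (\<lambda>x. 1 :: real)"
    by simp
  then show "integrable lborel f"
    using nonneg by (subst (asm) integrable_density) auto
  have "distr M borel X = density lborel (\<lambda>x. ennreal (f x))"
    unfolding distributed_distr_eq_density[OF X, symmetric] by (intro distr_cong) auto
  then show "char (distr M borel X) t = (CLINT x|lborel. f x *\<^sub>R iexp (t * x))"
    using nonneg by (simp add: char_def integral_density)
qed

text \<open>A density has integral 1, so it is finite almost everywhere, and \<open>enn2real\<close>
  alters it only on a null set.\<close>

lemma (in prob_space) distributed_ex_real_density:
  fixes X :: "'a \<Rightarrow> real"
  assumes X: "distributed M lborel X g"
  shows "\<exists>h. h \<in> borel_measurable borel \<and> (\<forall>x. 0 \<le> h x) \<and> distributed M lborel X (\<lambda>x. ennreal (h x))"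
proof (intro exI conjI allI)
  have g[measurable]: "g \<in> borel_measurable lborel"
    using X by (rule distributed_borel_measurable)
  show "(\<lambda>x. enn2real (g x)) \<in> borel_measurable borel"
    using g by simp
  have "X \<in> measurable M lborel"
    using X by (rule distributed_measurable)
  then interpret D: prob_space "density lborel g"
    unfolding distributed_distr_eq_density[OF X, symmetric] by (rule prob_space_distr)
  have "(\<integral>\<^sup>+x. g x \<partial>lborel) \<noteq> \<infinity>"
    using D.emeasure_space_1 by (simp add: emeasure_density)
  then have "AE x in lborel. g x \<noteq> \<infinity>"
    by (intro nn_integral_PInf_AE) auto
  then have "AE x in lborel. g x = ennreal (enn2real (g x))"
    by eventually_elim (simp add: less_top)
  then show "distributed M lborel X (\<lambda>x. ennreal (enn2real (g x)))"
    using X by (subst distributed_cong_density[symmetric]) auto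
qed simp

text \<open>XGamma is the mixture of the Erlang laws of shapes 1 and 3 with weights
  \<open>\<theta> / (1 + \<theta>)\<close> and \<open>1 / (1 + \<theta>)\<close>. At
  \<open>t = 0\<close> the identity fails, because the XGamma density is set to 0 there.\<close>

lemma xgamma_density_eq_erlang:
  assumes "\<theta> > 0" "t \<noteq> 0"
  shows "xgamma_density \<theta> t = \<theta>\<^sup>2 / (1 + \<theta>) * (erlang_density 0 \<theta> t / \<theta> + erlang_density 2 \<theta> t / \<theta>\<^sup>2)"
proof (cases "t > 0")
  case True
  have "erlang_density 0 \<theta> t / \<theta> = exp (- \<theta> * t)"
    "erlang_density 2 \<theta> t / \<theta>\<^sup>2 = \<theta> / 2 * t\<^sup>2 * exp (- \<theta> * t)"
    using assms(1) True by (simp_all add: erlang_density_def power2_eq_square power3_eq_cube)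
  then show ?thesis
    using True by (simp only: xgamma_density_def) (simp add: algebra_simps)
qed (use assms in \<open>simp add: xgamma_density_def erlang_density_def\<close>)

lemma Fourier_xgamma_density:
  fixes \<theta> t :: real and s :: complex
  assumes \<theta>: "\<theta> > 0"
  defines "s \<equiv> - \<i> * complex_of_real t"
  shows "(CLINT x|lborel. xgamma_density \<theta> x *\<^sub>R iexp (t * x)) =
    of_real (\<theta>\<^sup>2 / (1 + \<theta>)) * (((\<theta> + s)\<^sup>2 + \<theta>) / (\<theta> + s) ^ 3)"
proof -
  define c where "c = \<theta>\<^sup>2 / (1 + \<theta>)"
  define u where "u = \<theta> + s"
  define v where "v = complex_of_real \<theta>"
  have u: "\<theta> - \<i> * t = u" "u \<noteq> 0"
    using \<theta> by (auto simp: u_def s_def complex_eq_iff)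
  have v: "v \<noteq> 0"
    using \<theta> by (simp add: v_def)
  have int: "integrable lborel (\<lambda>x. z * (erlang_density k \<theta> x *\<^sub>R iexp (t * x)))" for k and z :: complex
    using \<theta> by (intro integrable_mult_right integrable_scaleR_iexp integrable_erlang_density)
  have lin: "(c * (p / \<theta> + q / \<theta>\<^sup>2)) *\<^sub>R E = c * (1 / v * (p *\<^sub>R E) + 1 / v\<^sup>2 * (q *\<^sub>R E))"
    for p q and E :: complex
    by (simp add: scaleR_conv_of_real v_def algebra_simps)
  have "(CLINT x|lborel. xgamma_density \<theta> x *\<^sub>R iexp (t * x)) =
      (CLINT x|lborel. c * (1 / v * (erlang_density 0 \<theta> x *\<^sub>R iexp (t * x)) +
        1 / v\<^sup>2 * (erlang_density 2 \<theta> x *\<^sub>R iexp (t * x))))"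
  proof (rule integral_cong_AE)
    show "AE x in lborel. xgamma_density \<theta> x *\<^sub>R iexp (t * x) =
        c * (1 / v * (erlang_density 0 \<theta> x *\<^sub>R iexp (t * x)) +
        1 / v\<^sup>2 * (erlang_density 2 \<theta> x *\<^sub>R iexp (t * x)))"
      using AE_lborel_singleton[of "0::real"]
    proof eventually_elim
      case (elim x)
      show ?case
        unfolding xgamma_density_eq_erlang[OF \<theta> elim] c_def[symmetric] by (rule lin)
    qed
  qed (simp_all add: xgamma_density_def[abs_def])
  also have "\<dots> = c * (1 / v * (v / u) ^ Suc 0 + 1 / v\<^sup>2 * (v / u) ^ Suc 2)"
    unfolding integral_mult_right_zero Bochner_Integration.integral_add[OF int int]
      Fourier_erlang_density[OF \<theta>] u v_def ..
  also have "\<dots> = c * ((u\<^sup>2 + v) / u ^ 3)"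
    using v u(2) by (simp add: field_simps power2_eq_square power3_eq_cube)
  finally show ?thesis
    unfolding c_def u_def v_def .
qed

text \<open>Linearity, with coefficients of arbitrary sign. The index \<open>m k\<close> is the
  exponent of the variable, so the shape is \<open>Suc (m k)\<close>.\<close>

lemma Fourier_erlang_combination:
  fixes c :: "'i \<Rightarrow> nat \<Rightarrow> real"
  assumes "finite I" "\<And>i. i \<in> I \<Longrightarrow> \<theta> i > 0"
  shows "integrable lborel (\<lambda>x. \<Sum>i\<in>I. \<Sum>k\<in>K. c i k * erlang_density (m k) (\<theta> i) x)"
    and "(CLINT x|lborel. (\<Sum>i\<in>I. \<Sum>k\<in>K. c i k * erlang_density (m k) (\<theta> i) x) *\<^sub>R iexp (t * x)) =
      (\<Sum>i\<in>I. \<Sum>k\<in>K. c i k * (\<theta> i / (\<theta> i - \<i> * t)) ^ Suc (m k))"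
proof -
  show "integrable lborel (\<lambda>x. \<Sum>i\<in>I. \<Sum>k\<in>K. c i k * erlang_density (m k) (\<theta> i) x)"
    using assms by (intro Bochner_Integration.integrable_sum integrable_mult_right integrable_erlang_density)
  have int: "integrable lborel (\<lambda>x. erlang_density k (\<theta> i) x *\<^sub>R iexp (t * x))" if "i \<in> I" for i k
    using assms that by (intro integrable_scaleR_iexp integrable_erlang_density)
  have "(CLINT x|lborel. (\<Sum>i\<in>I. \<Sum>k\<in>K. c i k * erlang_density (m k) (\<theta> i) x) *\<^sub>R iexp (t * x)) =
      (CLINT x|lborel. (\<Sum>i\<in>I. \<Sum>k\<in>K. c i k * (erlang_density (m k) (\<theta> i) x *\<^sub>R iexp (t * x))))"
    by (intro Bochner_Integration.integral_cong) (simp_all add: scaleR_conv_of_real sum_distrib_right mult.assoc)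
  also have "\<dots> = (\<Sum>i\<in>I. \<Sum>k\<in>K. CLINT x|lborel. c i k * (erlang_density (m k) (\<theta> i) x *\<^sub>R iexp (t * x)))"
  proof (subst Bochner_Integration.integral_sum)
    show "(\<Sum>i\<in>I. CLINT x|lborel. \<Sum>k\<in>K. c i k * (erlang_density (m k) (\<theta> i) x *\<^sub>R iexp (t * x))) =
        (\<Sum>i\<in>I. \<Sum>k\<in>K. CLINT x|lborel. c i k * (erlang_density (m k) (\<theta> i) x *\<^sub>R iexp (t * x)))"
      by (intro sum.cong refl Bochner_Integration.integral_sum integrable_mult_right int)
  qed (intro Bochner_Integration.integrable_sum integrable_mult_right int)
  also have "\<dots> = (\<Sum>i\<in>I. \<Sum>k\<in>K. c i k * (\<theta> i / (\<theta> i - \<i> * t)) ^ Suc (m k))"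
    using assms(2)
    by (intro sum.cong refl) (simp only: integral_mult_right_zero Fourier_erlang_density)
  finally show "(CLINT x|lborel. (\<Sum>i\<in>I. \<Sum>k\<in>K. c i k * erlang_density (m k) (\<theta> i) x) *\<^sub>R iexp (t * x)) =
      (\<Sum>i\<in>I. \<Sum>k\<in>K. c i k * (\<theta> i / (\<theta> i - \<i> * t)) ^ Suc (m k))" .
qed

text \<open>Partial fractions over the complex numbers at the real nodes \<open>\<theta> i\<close>;
  there all coefficients are images of the real ones under the coercion.\<close>

lemma coeff_partial_fractions:
  fixes \<theta> :: "nat \<Rightarrow> real" and s :: complex
  assumes n: "n \<ge> 1" and pos: "\<And>j. j \<in> {1..n} \<Longrightarrow> \<theta> j > 0" and inj: "inj_on \<theta> {1..n}"
    and s: "\<And>j. j \<in> {1..n} \<Longrightarrow> \<theta> j + s \<noteq> 0"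
  shows "(\<Prod>i\<in>{1..n}. ((\<theta> i + s)\<^sup>2 + \<theta> i) / (\<theta> i + s) ^ 3) =
    (\<Sum>i\<in>{1..n}. \<Sum>k=1..3. coeff_A n \<theta> i k / (\<theta> i + s) ^ (4 - k))"
proof -
  let ?\<theta> = "\<lambda>j. complex_of_real (\<theta> j)"
  have num: "(?\<theta> j - ?\<theta> i)\<^sup>2 + ?\<theta> j \<noteq> 0" if "i \<in> {1..n}" "j \<in> {1..n}" "i \<noteq> j" for i j
  proof -
    \<comment> \<open>A square plus a positive number is positive over the reals; only the resulting
      nonvanishing survives the passage to complex numbers.\<close>
    have "(\<theta> j - \<theta> i)\<^sup>2 + \<theta> j > 0"
      using pos[OF that(2)] by (intro add_nonneg_pos) auto
    then have "complex_of_real ((\<theta> j - \<theta> i)\<^sup>2 + \<theta> j) \<noteq> 0"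
      unfolding of_real_eq_0_iff by (rule less_imp_neq[symmetric])
    then show ?thesis
      unfolding of_real_add of_real_power of_real_diff .
  qed
  have inj': "inj_on ?\<theta> {1..n}"
    using inj unfolding inj_on_def of_real_eq_iff .
  have nz: "?\<theta> i \<noteq> 0" if "i \<in> {1..n}" for i
    using pos[OF that] by simp
  have three: "{1..3::nat} = {1, 2, 3}"
    by auto
  have ne: "{1..n} \<noteq> {}"
    using n by auto
  have "(\<Prod>i\<in>{1..n}. ((\<theta> i + s)\<^sup>2 + \<theta> i) / (\<theta> i + s) ^ 3) =
    (\<Sum>i\<in>{1..n}. coeff_A1 n \<theta> i / (\<theta> i + s) ^ 3 + coeff_A2 n \<theta> i / (\<theta> i + s)\<^sup>2 +
      coeff_A3 n \<theta> i / (\<theta> i + s))"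
    unfolding coeff_A1_def coeff_A2_def coeff_A3_def of_real_mult of_real_add of_real_diff
      of_real_divide of_real_prod of_real_sum of_real_power of_real_minus of_real_numeral
    by (rule partial_fractions[OF finite_atLeastAtMost ne inj' nz num s])
  also have "\<dots> = (\<Sum>i\<in>{1..n}. \<Sum>k=1..3. coeff_A n \<theta> i k / (\<theta> i + s) ^ (4 - k))"
    unfolding three by (rule sum.cong) (simp_all add: coeff_A_def)
  finally show ?thesis .
qed

theorem theorem2p1:
  fixes M :: "'a measure" and X :: "nat \<Rightarrow> 'a \<Rightarrow> real"
    and \<theta> :: "nat \<Rightarrow> real" and n :: nat
  assumes "prob_space M"
    and "n \<ge> 1"
    and "\<And>j. j \<in> {1..n} \<Longrightarrow> \<theta> j > 0"
    and "inj_on \<theta> {1..n}"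
    and "prob_space.indep_vars M (\<lambda>_. borel) X {1..n}"
    and "\<And>j. j \<in> {1..n} \<Longrightarrow> has_real_density M (X j) (xgamma_density (\<theta> j))"
  shows "has_real_density M (\<lambda>\<omega>. \<Sum>j=1..n. X j \<omega>)
    (\<lambda>t. \<Sum>i=1..n. \<Sum>k=1..3. coeff_R n \<theta> i k * erl_density (4 - k) (\<theta> i) t)"
proof -
  interpret prob_space M by fact
  define S where "S = (\<lambda>\<omega>. \<Sum>j=1..n. X j \<omega>)"
  define f where "f = (\<lambda>t. \<Sum>i=1..n. \<Sum>k=1..3. coeff_R n \<theta> i k * erl_density (4 - k) (\<theta> i) t)"
  define C where "C = (\<Prod>l\<in>{1..n}. (\<theta> l)\<^sup>2 / (1 + \<theta> l))"
  have X: "distributed M lborel (X j) (\<lambda>t. ennreal (xgamma_density (\<theta> j) t))"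
    "AE t in lborel. 0 \<le> xgamma_density (\<theta> j) t" if "j \<in> {1..n}" for j
    using assms(6)[OF that] by (simp_all add: has_real_density_def)
  \<comment> \<open>Nothing is needed about the form of \<open>g\<close>: any nonnegative real
    version \<open>h\<close> of it will be compared with \<open>f\<close> through
    transforms.\<close>
  obtain g where "distributed M lborel S g"
    using distributed_sum_ex_density[of "{1..n}" X] assms(2,5) X(1) unfolding S_def by auto
  then obtain h where h: "h \<in> borel_measurable borel" "\<And>x. 0 \<le> h x"
      "distributed M lborel S (\<lambda>x. ennreal (h x))"
    using distributed_ex_real_density by blast
  note hint = char_distributed[OF h(3,1)]
  have f_int: "integrable lborel f"
    unfolding f_def using assms(3) by (intro Fourier_erlang_combination) auto
  have eq: "(CLINT x|lborel. h x *\<^sub>R iexp (t * x)) = (CLINT x|lborel. f x *\<^sub>R iexp (t * x))" for t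
  proof -
    define s where "s = - \<i> * complex_of_real t"
    \<comment> \<open>The real part is \<open>\<theta> j\<close>, which is positive.\<close>
    have s: "\<theta> j + s \<noteq> 0" if "j \<in> {1..n}" for j
      using assms(3)[OF that] by (auto simp: s_def complex_eq_iff)
    have "(CLINT x|lborel. h x *\<^sub>R iexp (t * x)) = char (distr M borel S) t"
      using hint h(2) by simp
    also have "\<dots> = (\<Prod>j\<in>{1..n}. char (distr M borel (X j)) t)"
      unfolding S_def using assms(5) by (rule char_distr_sum)
    also have "\<dots> = (\<Prod>j\<in>{1..n}. of_real ((\<theta> j)\<^sup>2 / (1 + \<theta> j)) * (((\<theta> j + s)\<^sup>2 + \<theta> j) / (\<theta> j + s) ^ 3))"
    proof (rule prod.cong)
      fix j assume j: "j \<in> {1..n}"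
      have "xgamma_density (\<theta> j) \<in> borel_measurable borel"
        by (simp add: xgamma_density_def[abs_def])
      then show "char (distr M borel (X j)) t =
          of_real ((\<theta> j)\<^sup>2 / (1 + \<theta> j)) * (((\<theta> j + s)\<^sup>2 + \<theta> j) / (\<theta> j + s) ^ 3)"
        unfolding s_def using Fourier_xgamma_density[OF assms(3)[OF j]] X[OF j]
        by (simp only: char_distributed(2))
    qed simp
    also have "\<dots> = C * (\<Sum>i\<in>{1..n}. \<Sum>k=1..3. coeff_A n \<theta> i k / (\<theta> i + s) ^ (4 - k))"
      unfolding prod.distrib C_def of_real_prod
      by (simp only: coeff_partial_fractions[OF assms(2,3,4) s])
    also have "\<dots> = (\<Sum>i\<in>{1..n}. \<Sum>k=1..3. coeff_R n \<theta> i k * (\<theta> i / (\<theta> i - \<i> * t)) ^ Suc (4 - k - 1))"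
      unfolding sum_distrib_left
    proof (intro sum.cong refl)
      fix i k assume i: "i \<in> {1..n}" and k: "k \<in> {1..3::nat}"
      \<comment> \<open>Subtraction on naturals truncates, so this uses \<open>k\<close> at most 3.
        The power of \<open>\<theta> i\<close> then cancels against the one dividing in
        \<open>coeff_R\<close>.\<close>
      have "Suc (4 - k - 1) = 4 - k"
        using k by auto
      moreover have "complex_of_real (\<theta> i) \<noteq> 0"
        using assms(3)[OF i] by simp
      ultimately show "C * (coeff_A n \<theta> i k / (\<theta> i + s) ^ (4 - k)) =
          coeff_R n \<theta> i k * (\<theta> i / (\<theta> i - \<i> * t)) ^ Suc (4 - k - 1)"
        unfolding coeff_R_def C_def[symmetric] by (simp only:) (simp add: power_divide s_def)
    qed
    also have "\<dots> = (CLINT x|lborel. f x *\<^sub>R iexp (t * x))"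
      unfolding f_def using assms(3) by (intro Fourier_erlang_combination(2)[symmetric]) auto
    finally show ?thesis .
  qed
  have "AE x in lborel. h x - f x = 0"
  proof (rule Fourier_zero_imp_AE_zero)
    show "integrable lborel (\<lambda>x. h x - f x)"
      using hint(1) h(2) f_int by simp
    show "(CLINT x|lborel. (h x - f x) *\<^sub>R iexp (t * x)) = 0" for t
      using eq[of t] integrable_scaleR_iexp[OF hint(1), of t] integrable_scaleR_iexp[OF f_int, of t] h(2)
      by (simp add: scaleR_diff_left)
  qed
  then have hf: "AE x in lborel. h x = f x"
    by simp
  \<comment> \<open>The signs of the coefficients are never examined: nonnegativity of
    \<open>f\<close> is inherited from \<open>h\<close>.\<close>
  then have "AE x in lborel. 0 \<le> f x"
    by eventually_elim (use h(2) in metis)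
  moreover have "distributed M lborel S (\<lambda>x. ennreal (f x))"
    using hf h f_int by (subst distributed_cong_density[symmetric, where f = "\<lambda>x. ennreal (h x)"]) auto
  ultimately show ?thesis
    unfolding has_real_density_def S_def f_def by blast
qed

end
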